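(* Let $X$ be a normed space, let $\mathcal{C}\subset X$ be a co-radiant subset such that $d_{\mathcal{C}}>0$, let $A\subset X$, $\varepsilon>0$, and $\lambda>0$. If $(f,\alpha)\in\mathcal{C}^{a\#}_{\lambda}(\varepsilon)$, then $$AE(A,\mathcal{K}_{f,\alpha},\lambda)\subset PAE(A,\mathcal{C},\varepsilon).$$
   Context: $X$ is a real normed space with dual $X^*$ and dual norm $\|\cdot\|_*$. A co-radiant set is a set $\mathcal{C}\subset X$ with $\mathcal{C}\ne\emptyset$, $\mathcal{C}\neq X$ (proper) and $\lambda x\in\mathcal{C}$ for all $\lambda\ge1$, $x\in\mathcal{C}$. For $\varepsilon>0$, $\mathcal{C}(\varepsilon):=\varepsilon\,\mathcal{C}$, and $d_{\mathcal{C}}:=\inf\{\|c\|:c\in\mathcal{C}\}$. A set $S$ is pointed if $S\cap(-S)\subset\{0_X\}$, and solid if $\mathrm{int}(S)\neq\emptyset$. $\mathcal{C}^{\#}:=\{f\in X^*: f(y)>0\ \forall y\in\mathcal{C}\}$. With $\mathbb{R}_+=(0,+\infty)$ and $\varepsilon,\lambda>0$: $$\mathcal{C}^{a\#}_{\lambda}(\varepsilon):=\{(f,\alpha)\in\mathcal{C}^{\#}\times\mathbb{R}_+: f(y)-\alpha\|y\|>\lambda\ \forall y\in\mathcal{C}(\varepsilon)\}.$$ For a proper pointed co-radiant set $\mathcal{C}$, $A\subset X$ and $\varepsilon>0$, a point $x_0\in A$ is an $\varepsilon$-efficient point with respect to $\mathcal{C}$, written $x_0\in AE(A,\mathcal{C},\varepsilon)$,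 if $(A-x_0)\cap(-\mathcal{C}(\varepsilon))\subset\{0_X\}$. A point $x_0\in A$ is an $\varepsilon$-properly efficient point with respect to $\mathcal{C}$, written $x_0\in PAE(A,\mathcal{C},\varepsilon)$, if there exists a proper solid pointed co-radiant set $\mathcal{K}\subset X$ such that $\mathcal{C}\subset\mathrm{int}(\mathcal{K})$ and $x_0\in AE(A,\mathcal{K},\varepsilon)$. (If $\mathcal{C}^{\#}\ne\emptyset$, then $\mathcal{C}$ is pointed.) For $f\in X^*$ and $0<\alpha<\|f\|_*$: $\mathcal{K}_{f,\alpha}:=\{x\in X: f(x)-\alpha\|x\|>1\}$ (a proper pointed co-radiant set); $(f,\alpha)\in\mathcal{C}^{a\#}_{\lambda}(\varepsilon)$ forces $\alpha<\|f\|_*$. *)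

theory Defs
  imports "HOL-Analysis.Bounded_Linear_Function"
begin

text \<open>
  The dual space of a real normed space \<open>'a\<close> is the type \<open>'a \<Rightarrow>\<^sub>L real\<close> of bounded linear
  functionals, whose norm is the operator norm.
\<close>

definition co_radiant :: "'a::real_normed_vector set \<Rightarrow> bool" where
  "co_radiant C \<longleftrightarrow> C \<noteq> {} \<and> C \<noteq> UNIV \<and> (\<forall>t\<ge>1. \<forall>x\<in>C. t *\<^sub>R x \<in> C)"

definition pointed :: "'a::real_normed_vector set \<Rightarrow> bool" where
  "pointed S \<longleftrightarrow> S \<inter> uminus ` S \<subseteq> {0}"

definition solid :: "'a::real_normed_vector set \<Rightarrow> bool" where
  "solid S \<longleftrightarrow> interior S \<noteq> {}"

definition dilate :: "'a::real_normed_vector set \<Rightarrow> real \<Rightarrow> 'a set" where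
  "dilate C \<epsilon> = (\<lambda>x. \<epsilon> *\<^sub>R x) ` C"

definition dist_origin :: "'a::real_normed_vector set \<Rightarrow> real" where
  "dist_origin C = (INF c\<in>C. norm c)"

definition pos_dual :: "'a::real_normed_vector set \<Rightarrow> ('a \<Rightarrow>\<^sub>L real) set" where
  "pos_dual C = {f. \<forall>y\<in>C. blinfun_apply f y > 0}"

definition aug_dual ::
  "'a::real_normed_vector set \<Rightarrow> real \<Rightarrow> real \<Rightarrow> (('a \<Rightarrow>\<^sub>L real) \<times> real) set" where
  "aug_dual C l \<epsilon> = {(f, \<alpha>). f \<in> pos_dual C \<and> \<alpha> > 0 \<and>
     (\<forall>y\<in>dilate C \<epsilon>. blinfun_apply f y - \<alpha> * norm y > l)}"

text \<open>
  The sets of approximate efficient points are meant for pointed co-radiant \<open>C\<close> and \<open>\<epsilon> > 0\<close>;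
  the definitions are total and do not enforce this.
\<close>

definition approx_eff :: "'a::real_normed_vector set \<Rightarrow> 'a set \<Rightarrow> real \<Rightarrow> 'a set" where
  "approx_eff A C \<epsilon> = {x\<^sub>0\<in>A. (\<lambda>a. a - x\<^sub>0) ` A \<inter> uminus ` dilate C \<epsilon> \<subseteq> {0}}"

definition proper_approx_eff :: "'a::real_normed_vector set \<Rightarrow> 'a set \<Rightarrow> real \<Rightarrow> 'a set" where
  "proper_approx_eff A C \<epsilon> = {x\<^sub>0\<in>A. \<exists>K. co_radiant K \<and> solid K \<and> pointed K \<and> C \<subseteq> interior K \<and> x\<^sub>0 \<in> approx_eff A K \<epsilon>}"

text \<open>Meant for \<open>0 < \<alpha> < norm f\<close>, in which case the set is co-radiant and pointed.\<close>

definition K_set :: "('a::real_normed_vector \<Rightarrow>\<^sub>L real) \<Rightarrow> real \<Rightarrow> 'a set" where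
  "K_set f \<alpha> = {x. blinfun_apply f x - \<alpha> * norm x > 1}"

end

theory Submission
  imports Defs
begin

text \<open>
  The superlevel sets of the positively homogeneous function \<open>f - \<alpha> \<parallel>\<cdot>\<parallel>\<close> at positive levels are
  open, pointed and dilates of one another. The superlevel set at level \<open>l / \<epsilon>\<close> contains \<open>C\<close>, and
  its dilate by \<open>\<epsilon>\<close> equals the dilate of \<open>K_set f \<alpha>\<close> by \<open>l\<close>.
\<close>

definition superlevel :: "('a::real_normed_vector \<Rightarrow>\<^sub>L real) \<Rightarrow> real \<Rightarrow> real \<Rightarrow> 'a set" where
  "superlevel f \<alpha> c = {x. blinfun_apply f x - \<alpha> * norm x > c}"

lemma K_set_eq_superlevel: "K_set f \<alpha> = superlevel f \<alpha> 1"
  by (simp add: K_set_def superlevel_def)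

lemma open_superlevel: "open (superlevel f \<alpha> c)"
  unfolding superlevel_def by (intro open_Collect_less continuous_intros)

text \<open>The function \<open>f - \<alpha> * norm\<close> is positively homogeneous, so scaling a
  point by t > 0 scales its value, and hence the level, by t.\<close>

lemma scaleR_mem_superlevel_iff:
  assumes "t > 0"
  shows "t *\<^sub>R x \<in> superlevel f \<alpha> (t * c) \<longleftrightarrow> x \<in> superlevel f \<alpha> c"
proof -
  have "f (t *\<^sub>R x) - \<alpha> * norm (t *\<^sub>R x) = t * (f x - \<alpha> * norm x)"
    using assms by (simp add: blinfun.scaleR_right algebra_simps)
  then show ?thesis
    using assms by (simp add: superlevel_def)
qed

lemma dilate_superlevel:
  assumes "t > 0"
  shows "dilate (superlevel f \<alpha> c) t = superlevel f \<alpha> (t * c)"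
proof
  show "dilate (superlevel f \<alpha> c) t \<subseteq> superlevel f \<alpha> (t * c)"
    using assms by (auto simp: dilate_def scaleR_mem_superlevel_iff)
next
  show "superlevel f \<alpha> (t * c) \<subseteq> dilate (superlevel f \<alpha> c) t"
  proof
    fix y
    assume "y \<in> superlevel f \<alpha> (t * c)"
    moreover have y: "y = t *\<^sub>R ((1 / t) *\<^sub>R y)"
      using assms by simp
    ultimately have "(1 / t) *\<^sub>R y \<in> superlevel f \<alpha> c"
      using scaleR_mem_superlevel_iff[OF assms] by metis
    with y show "y \<in> dilate (superlevel f \<alpha> c) t"
      unfolding dilate_def by blast
  qed
qed

lemma superlevel_antimono: "c \<le> d \<Longrightarrow> superlevel f \<alpha> d \<subseteq> superlevel f \<alpha> c"
  by (auto simp: superlevel_def)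

text \<open>Scaling by t \<ge> 1 lifts the level from c to t * c, which is at least c because c is
  nonnegative. The set is proper since the defining function vanishes at 0.\<close>

lemma co_radiant_superlevel:
  assumes "c \<ge> 0" and "superlevel f \<alpha> c \<noteq> {}"
  shows "co_radiant (superlevel f \<alpha> c)"
  unfolding co_radiant_def
proof (intro conjI allI impI ballI)
  show "superlevel f \<alpha> c \<noteq> {}"
    by fact
  have "0 \<notin> superlevel f \<alpha> c"
    using assms(1) by (simp add: superlevel_def)
  then show "superlevel f \<alpha> c \<noteq> UNIV"
    by blast
next
  fix t :: real and x
  assume t: "1 \<le> t" and "x \<in> superlevel f \<alpha> c"
  then have "t *\<^sub>R x \<in> superlevel f \<alpha> (t * c)"
    by (simp add: scaleR_mem_superlevel_iff)
  moreover have "c \<le> t * c"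
    using mult_right_mono[OF t assms(1)] by simp
  ultimately show "t *\<^sub>R x \<in> superlevel f \<alpha> c"
    using superlevel_antimono by blast
qed

text \<open>On this set \<open>f\<close> exceeds c + \<alpha> * \<open>norm x\<close>, hence is
  positive; as \<open>f\<close> is odd, x and -x cannot both belong.\<close>

lemma pointed_superlevel:
  assumes "c \<ge> 0" and "\<alpha> \<ge> 0"
  shows "pointed (superlevel f \<alpha> c)"
proof -
  have pos: "f x > 0" if "x \<in> superlevel f \<alpha> c" for x
    using that assms mult_nonneg_nonneg[OF assms(2) norm_ge_zero[of x]]
    unfolding superlevel_def mem_Collect_eq by linarith
  have "- x \<notin> superlevel f \<alpha> c" if "x \<in> superlevel f \<alpha> c" for x
    using pos[OF that] pos[of "- x"] by (auto simp: blinfun.minus_right)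
  then show ?thesis
    by (auto simp: pointed_def)
qed

theorem proposition5p7:
  fixes C A :: "'a::real_normed_vector set"
    and f :: "'a \<Rightarrow>\<^sub>L real"
    and \<alpha> \<epsilon> l :: real
  assumes "co_radiant C"
    and "dist_origin C > 0"
    and "\<epsilon> > 0"
    and "l > 0"
    and "(f, \<alpha>) \<in> aug_dual C l \<epsilon>"
  shows "approx_eff A (K_set f \<alpha>) l \<subseteq> proper_approx_eff A C \<epsilon>"
proof
  \<comment> \<open>The witness for proper efficiency; its level is the one that dilation by
    \<epsilon> turns into l.\<close>
  let ?K = "superlevel f \<alpha> (l / \<epsilon>)"
  fix x
  assume x: "x \<in> approx_eff A (K_set f \<alpha>) l"
  have "\<alpha> > 0" and dilate_C: "dilate C \<epsilon> \<subseteq> superlevel f \<alpha> l"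
    using assms(5) by (auto simp: aug_dual_def superlevel_def)
  have "C \<subseteq> ?K"
  proof
    fix y
    assume "y \<in> C"
    then have "\<epsilon> *\<^sub>R y \<in> superlevel f \<alpha> (\<epsilon> * (l / \<epsilon>))"
      using dilate_C assms(3) by (auto simp: dilate_def)
    then show "y \<in> ?K"
      using scaleR_mem_superlevel_iff[OF assms(3)] by blast
  qed
  then have "?K \<noteq> {}"
    using assms(1) by (auto simp: co_radiant_def)
  \<comment> \<open>By openness, containing \<open>C\<close> already means containing it in the
    interior, and nonemptiness gives solidity.\<close>
  moreover have "interior ?K = ?K"
    by (simp add: interior_open open_superlevel)
  \<comment> \<open>Both sides are the superlevel set at level l. Since \<open>approx_eff\<close>
    sees its cone-like set only through the dilate, the two efficiency conditions on x
    coincide.\<close>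
  moreover have "dilate ?K \<epsilon> = dilate (K_set f \<alpha>) l"
    using assms(3,4) by (simp add: K_set_eq_superlevel dilate_superlevel)
  ultimately have "co_radiant ?K" "solid ?K" "pointed ?K" "C \<subseteq> interior ?K"
    "x \<in> approx_eff A ?K \<epsilon>"
    using x \<open>C \<subseteq> ?K\<close> \<open>\<alpha> > 0\<close> assms(3,4)
    by (simp_all add: co_radiant_superlevel solid_def pointed_superlevel approx_eff_def)
  moreover have "x \<in> A"
    using x by (simp add: approx_eff_def)
  ultimately show "x \<in> proper_approx_eff A C \<epsilon>"
    unfolding proper_approx_eff_def by blast
qed

end
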